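(* Let $k\geq 1$ and let $n=p_0p_1p_2\cdots p_k$, where $p_0=2<p_1<p_2<\dots<p_k$ are distinct primes. Suppose that the $n$-th cyclotomic polynomial $\Phi_n(x)$ is flat. Let $\zeta_n\in\mathbb{C}$ be a primitive $n$-th root of unity. Then $\Phi_n^T(\zeta_n)=0$ is a minimal vanishing sum of $n$-th roots of unity.
   Context: $\Phi_n(x)$ denotes the $n$-th cyclotomic polynomial. It is called flat if the maximum absolute value of its coefficients is $1$ (i.e. all its coefficients lie in $\{-1,0,1\}$). For even $n$ with $\Phi_n(x)$ flat, write uniquely $\Phi_n(x)=f_1(x)-f_2(x)$, where $f_1,f_2$ are polynomials all of whose nonzero coefficients are positive (hence equal to $1$) and no power of $x$ occurs in both $f_1$ and $f_2$. Define $\Phi_n^T(x)=f_1(x)+x^{n/2}f_2(x)$, a polynomial with coefficients in $\{0,1\}$. A vanishing sum of (distinct) $n$-th roots of unity is an equation $\zeta_n^{k_1}+\dots+\zeta_n^{k_l}=0$ with $l\ge 1$ and distinct $k_1,\dots,k_l\in\{0,1,\dots,n-1\}$. It is minimal if no proper nonempty sub-sum is zero. For a polynomial $f$ with coefficients in $\{0,1\}$ and degree at most $n-1$, saying that $f(\zeta_n)=0$ is a (minimal) vanishing sum refers to the sum of the roots of unity $\zeta_n^e$ over all exponents $e$ occurring in $f$. *)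

theory Defs
  imports Complex_Main "HOL-Computational_Algebra.Computational_Algebra"
begin

definition primitive_root_unity :: "nat \<Rightarrow> complex \<Rightarrow> bool" where
  "primitive_root_unity n z \<longleftrightarrow> n > 0 \<and> z ^ n = 1 \<and> (\<forall>m. 0 < m \<and> m < n \<longrightarrow> z ^ m \<noteq> 1)"

definition cyclotomic_complex :: "nat \<Rightarrow> complex poly" where
  "cyclotomic_complex n = (\<Prod>z | primitive_root_unity n z. [:- z, 1:])"

text \<open>
  The cyclotomic polynomial as an integer polynomial. That such a polynomial exists (for every
  \<open>n\<close>) and is unique is \<open>cyclotomic_ex1\<close> below.
\<close>
definition cyclotomic :: "nat \<Rightarrow> int poly" where
  "cyclotomic n = (THE p. map_poly of_int p = cyclotomic_complex n)"

lemma int_poly_mult: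
  fixes p q :: "complex poly"
  assumes "\<forall>i. coeff p i \<in> \<int>" "\<forall>i. coeff q i \<in> \<int>"
  shows "\<forall>i. coeff (p * q) i \<in> \<int>"
  using assms by (auto simp: coeff_mult intro!: Ints_sum Ints_mult)

lemma int_poly_prod:
  fixes f :: "'b \<Rightarrow> complex poly"
  assumes "\<And>x. x \<in> A \<Longrightarrow> \<forall>i. coeff (f x) i \<in> \<int>"
  shows "\<forall>i. coeff (prod f A) i \<in> \<int>"
  using assms
proof (induction A rule: infinite_finite_induct)
  case (insert x F)
  then have "\<forall>i. coeff (f x * prod f F) i \<in> \<int>" by (intro int_poly_mult) auto
  with insert show ?case by simp
qed (auto simp: coeff_1 simp flip: one_pCons split: if_splits)

lemma int_poly_monic_div:
  fixes g h :: "complex poly"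
  assumes f: "\<forall>i. coeff (g * h) i \<in> \<int>" and g: "\<forall>i. coeff g i \<in> \<int>" and monic: "lead_coeff g = 1"
  shows "coeff h i \<in> \<int>"
proof (induction "degree h - i" arbitrary: i rule: less_induct)
  case less
  show ?case
  proof (cases "i > degree h")
    case True
    then show ?thesis by (simp add: coeff_eq_0)
  next
    case False
    have step: "coeff h j \<in> \<int>" if "j > i" for j
      using less[of j] that False by (cases "j > degree h") (auto simp: coeff_eq_0)
    let ?d = "degree g"
    have "coeff (g * h) (?d + i) = (\<Sum>j\<le>?d + i. coeff g j * coeff h (?d + i - j))"
      by (simp add: coeff_mult)
    also have "\<dots> = (\<Sum>j\<le>?d. coeff g j * coeff h (?d + i - j))"
      by (rule sum.mono_neutral_right) (auto simp: coeff_eq_0)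
    also have "\<dots> = coeff h i + (\<Sum>j<?d. coeff g j * coeff h (?d + i - j))"
      using monic by (simp add: lessThan_Suc_atMost[symmetric])
    finally have "coeff h i = coeff (g * h) (?d + i) - (\<Sum>j<?d. coeff g j * coeff h (?d + i - j))"
      by simp
    also have "\<dots> \<in> \<int>"
      using f g step by (intro Ints_diff Ints_sum Ints_mult) auto
    finally show ?thesis .
  qed
qed

lemma lead_coeff_prod_linear:
  fixes A :: "complex set"
  shows "lead_coeff (\<Prod>z\<in>A. [:- z, 1:]) = 1"
  by (simp add: lead_coeff_prod)

lemma prod_roots_unity:
  assumes "n > 0"
  shows "(\<Prod>z | z ^ n = (1::complex). [:- z, 1:]) = monom 1 n - 1"
proof -
  let ?A = "{z::complex. z ^ n = 1}"
  let ?P = "\<Prod>z\<in>?A. [:- z, 1:]"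
  have fin: "finite ?A" using assms by (intro finite_roots_unity) auto
  have deg: "degree ?P = n"
    using card_roots_unity_eq[of n] assms by (subst degree_prod_sum_eq) auto
  have lc: "coeff ?P n = 1" using lead_coeff_prod_linear[of ?A] deg by simp
  have "?P - (monom 1 n - 1) = 0"
  proof (rule ccontr)
    let ?D = "?P - (monom 1 n - 1)"
    assume nz: "?D \<noteq> 0"
    have "degree ?P \<le> n" "degree (monom (1::complex) n - 1) \<le> n"
      using deg by (auto intro!: degree_diff_le simp: degree_monom_le)
    then have "degree ?D \<le> n" by (rule degree_diff_le)
    moreover have "coeff ?D n = 0" using lc assms by (simp add: coeff_1)
    ultimately have "degree ?D < n"
      using nz by (metis le_neq_implies_less leading_coeff_0_iff)
    moreover have "?A \<subseteq> {z. poly ?D z = 0}"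
      using fin by (auto simp: poly_prod poly_monom)
    then have "card ?A \<le> card {z. poly ?D z = 0}"
      by (intro card_mono poly_roots_finite nz)
    then have "n \<le> degree ?D"
      using card_roots_unity_eq[of n] assms card_poly_roots_bound[OF nz] by simp
    ultimately show False by simp
  qed
  then show ?thesis by simp
qed

lemma primitive_root_unity_unique:
  assumes "primitive_root_unity m z" "primitive_root_unity n z"
  shows "m = n"
  using assms unfolding primitive_root_unity_def by (metis linorder_neqE_nat)

lemma root_unity_primitive:
  assumes "n > 0" "z ^ n = 1"
  shows "\<exists>d. d dvd n \<and> primitive_root_unity d z"
proof -
  define d where "d = (LEAST d. d > 0 \<and> z ^ d = 1)"
  have d: "d > 0 \<and> z ^ d = 1" unfolding d_def by (rule LeastI[of _ n]) (use assms in auto)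
  have least: "z ^ m \<noteq> 1" if "0 < m" "m < d" for m
    using not_less_Least[of m "\<lambda>d. d > 0 \<and> z ^ d = 1"] that unfolding d_def by auto
  have "z ^ n = (z ^ d) ^ (n div d) * z ^ (n mod d)"
    by (metis mult_div_mod_eq power_add power_mult)
  then have "z ^ (n mod d) = 1" using d assms by simp
  then have "n mod d = 0" using least[of "n mod d"] d by (cases "n mod d = 0") auto
  then show ?thesis using d least unfolding primitive_root_unity_def by auto
qed

lemma finite_primitive_roots: "finite {z. primitive_root_unity n z}"
proof (cases "n = 0")
  case False
  then have "finite {z::complex. z ^ n = 1}" by (intro finite_roots_unity) auto
  then show ?thesis by (rule rev_finite_subset) (auto simp: primitive_root_unity_def)
qed (simp add: primitive_root_unity_def)

lemma roots_unity_Union: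
  assumes "n > 0"
  shows "{z::complex. z ^ n = 1} = (\<Union>d\<in>{d. d dvd n}. {z. primitive_root_unity d z})"
  using root_unity_primitive[OF assms]
  by (auto simp: primitive_root_unity_def dvd_def power_mult)

lemma prod_cyclotomic_complex:
  assumes "n > 0"
  shows "(\<Prod>d | d dvd n. cyclotomic_complex d) = monom 1 n - 1"
  unfolding cyclotomic_complex_def prod_roots_unity[OF assms, symmetric] roots_unity_Union[OF assms]
  by (rule prod.UNION_disjoint[symmetric])
     (use assms in \<open>auto simp: finite_primitive_roots dest: primitive_root_unity_unique\<close>)

lemma cyclotomic_complex_int: "\<forall>i. coeff (cyclotomic_complex n) i \<in> \<int>"
proof (induction n rule: less_induct)
  case (less n)
  show ?case
  proof (cases "n = 0")
    case True
    then show ?thesis by (auto simp: cyclotomic_complex_def primitive_root_unity_def coeff_1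
        simp flip: one_pCons)
  next
    case False
    let ?g = "\<Prod>d | d dvd n \<and> d \<noteq> n. cyclotomic_complex d"
    have "{d. d dvd n} = insert n {d. d dvd n \<and> d \<noteq> n}" by auto
    moreover have "finite {d. d dvd n \<and> d \<noteq> n}" using False by simp
    ultimately have eq: "?g * cyclotomic_complex n = monom 1 n - 1"
      using prod_cyclotomic_complex[of n] False by (simp add: mult.commute)
    have "\<forall>i. coeff ?g i \<in> \<int>"
      using less False by (intro int_poly_prod) (auto dest: dvd_imp_le)
    moreover have "lead_coeff ?g = 1"
      by (simp add: lead_coeff_prod cyclotomic_complex_def)
    moreover have "\<forall>i. coeff (?g * cyclotomic_complex n) i \<in> \<int>"
      by (auto simp: eq coeff_1)
    ultimately show ?thesis using int_poly_monic_div by blast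
  qed
qed

lemma cyclotomic_ex1: "\<exists>!p. map_poly of_int p = cyclotomic_complex n"
proof (rule ex_ex1I)
  let ?p = "map_poly (\<lambda>c. \<lfloor>Re c\<rfloor>) (cyclotomic_complex n)"
  have "map_poly of_int ?p = cyclotomic_complex n"
  proof (rule poly_eqI)
    fix i
    obtain c where "coeff (cyclotomic_complex n) i = of_int c"
      using cyclotomic_complex_int[of n] Ints_cases by blast
    then show "coeff (map_poly of_int ?p) i = coeff (cyclotomic_complex n) i"
      by (simp add: coeff_map_poly)
  qed
  then show "\<exists>p. map_poly of_int p = cyclotomic_complex n" ..
next
  fix p q :: "int poly"
  assume "map_poly of_int p = cyclotomic_complex n" "map_poly of_int q = cyclotomic_complex n"
  then have "coeff (map_poly of_int p) i = coeff (map_poly (of_int :: int \<Rightarrow> complex) q) i" for i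
    by simp
  then show "p = q" by (intro poly_eqI) (simp add: coeff_map_poly)
qed

lemma of_int_cyclotomic: "map_poly of_int (cyclotomic n) = cyclotomic_complex n"
  unfolding cyclotomic_def by (rule theI'[OF cyclotomic_ex1])

definition flat :: "int poly \<Rightarrow> bool" where
  "flat p \<longleftrightarrow> Max (range (\<lambda>i. \<bar>coeff p i\<bar>)) = 1"

lemma finite_range_abs_coeff: "finite (range (\<lambda>i. \<bar>coeff p i\<bar>))" for p :: "int poly"
proof (rule finite_subset)
  show "range (\<lambda>i. \<bar>coeff p i\<bar>) \<subseteq> insert 0 ((\<lambda>i. \<bar>coeff p i\<bar>) ` {..degree p})"
    by (auto simp: image_iff) (metis atMost_iff le_degree)
qed simp

lemma flat_iff: "flat p \<longleftrightarrow> p \<noteq> 0 \<and> (\<forall>i. coeff p i \<in> {-1, 0, 1})"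
proof -
  have abs_le: "\<bar>c\<bar> \<le> 1 \<longleftrightarrow> c \<in> {-1, 0, 1}" for c :: int by auto
  have "flat p \<longleftrightarrow> 1 \<in> range (\<lambda>i. \<bar>coeff p i\<bar>) \<and> (\<forall>a\<in>range (\<lambda>i. \<bar>coeff p i\<bar>). a \<le> 1)"
    unfolding flat_def by (rule Max_eq_iff) (simp_all add: finite_range_abs_coeff)
  also have "\<dots> \<longleftrightarrow> (\<exists>i. \<bar>coeff p i\<bar> = 1) \<and> (\<forall>i. coeff p i \<in> {-1, 0, 1})"
    unfolding abs_le[symmetric] by (metis (mono_tags, lifting) rangeE rangeI)
  also have "\<dots> \<longleftrightarrow> p \<noteq> 0 \<and> (\<forall>i. coeff p i \<in> {-1, 0, 1})"
  proof (rule rev_conj_cong)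
    assume *: "\<forall>i. coeff p i \<in> {-1, 0, 1}"
    have "\<bar>coeff p i\<bar> = 1 \<longleftrightarrow> coeff p i \<noteq> 0" for i
      using *[rule_format, of i] by auto
    then show "(\<exists>i. \<bar>coeff p i\<bar> = 1) \<longleftrightarrow> p \<noteq> 0"
      by (simp add: poly_eq_iff)
  qed simp
  finally show ?thesis .
qed

definition pos_neg_parts :: "int poly \<Rightarrow> int poly \<Rightarrow> int poly \<Rightarrow> bool" where
  "pos_neg_parts p f1 f2 \<longleftrightarrow>
     p = f1 - f2 \<and>
     (\<forall>i. coeff f1 i \<noteq> 0 \<longrightarrow> coeff f1 i > 0) \<and>
     (\<forall>i. coeff f2 i \<noteq> 0 \<longrightarrow> coeff f2 i > 0) \<and>
     (\<forall>i. \<not> (coeff f1 i \<noteq> 0 \<and> coeff f2 i \<noteq> 0))"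

lemma pos_neg_parts_iff:
  "pos_neg_parts p f1 f2 \<longleftrightarrow>
     f1 = map_poly (\<lambda>c. max c 0) p \<and> f2 = map_poly (\<lambda>c. max (- c) 0) p"
proof -
  have "pos_neg_parts p f1 f2 \<longleftrightarrow>
     (\<forall>i. coeff p i = coeff f1 i - coeff f2 i \<and> coeff f1 i \<ge> 0 \<and> coeff f2 i \<ge> 0 \<and>
        (coeff f1 i = 0 \<or> coeff f2 i = 0))"
    unfolding pos_neg_parts_def poly_eq_iff coeff_diff by (auto simp: le_less)
  also have "\<dots> \<longleftrightarrow> (\<forall>i. coeff f1 i = max (coeff p i) 0 \<and> coeff f2 i = max (- coeff p i) 0)"
    by (rule all_cong1) (auto simp: max_def)
  finally show ?thesis by (auto simp: poly_eq_iff coeff_map_poly)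
qed

definition cyclotomic_T :: "nat \<Rightarrow> int poly" where
  "cyclotomic_T n =
     (THE q. \<exists>f1 f2. pos_neg_parts (cyclotomic n) f1 f2 \<and> q = f1 + monom 1 (n div 2) * f2)"

lemma cyclotomic_T_eq:
  assumes "pos_neg_parts (cyclotomic n) f1 f2"
  shows "cyclotomic_T n = f1 + monom 1 (n div 2) * f2"
  unfolding cyclotomic_T_def
  by (rule the_equality) (use assms in \<open>auto simp: pos_neg_parts_iff\<close>)

text \<open>
  A sum of distinct powers of \<open>z\<close> is given by its nonempty set \<open>K\<close> of exponents in
  \<open>{0, \<dots>, n - 1}\<close>; in use, \<open>z\<close> is a primitive \<open>n\<close>-th root of unity.
\<close>
definition vanishing_sum :: "nat \<Rightarrow> complex \<Rightarrow> nat set \<Rightarrow> bool" where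
  "vanishing_sum n z K \<longleftrightarrow> K \<noteq> {} \<and> K \<subseteq> {0..<n} \<and> (\<Sum>e\<in>K. z ^ e) = 0"

definition minimal_vanishing_sum :: "nat \<Rightarrow> complex \<Rightarrow> nat set \<Rightarrow> bool" where
  "minimal_vanishing_sum n z K \<longleftrightarrow>
     vanishing_sum n z K \<and> (\<forall>J. J \<noteq> {} \<and> J \<subset> K \<longrightarrow> (\<Sum>e\<in>J. z ^ e) \<noteq> 0)"

text \<open>
  \<open>f(z) = 0\<close> is a minimal vanishing sum; this includes that \<open>f\<close> has coefficients in \<open>{0, 1}\<close> and
  (through \<open>vanishing_sum\<close>) degree at most \<open>n - 1\<close>.
\<close>
definition poly_minimal_vanishing_sum :: "nat \<Rightarrow> complex \<Rightarrow> int poly \<Rightarrow> bool" where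
  "poly_minimal_vanishing_sum n z f \<longleftrightarrow>
     (\<forall>i. coeff f i \<in> {0, 1}) \<and>
     poly (map_poly of_int f) z = 0 \<and>
     minimal_vanishing_sum n z {e. coeff f e \<noteq> 0}"

end

theory Submission
  imports Defs "HOL-Number_Theory.Cong"
begin

text \<open>
  Write \<open>n = 2m\<close> with \<open>m > 1\<close> odd. Since \<open>\<zeta>\<^sup>m = -1\<close> and \<open>deg \<Phi>\<^sub>n < m\<close>, folding the exponents \<open>e \<ge> m\<close>
  back to \<open>e - m\<close> with a change of sign turns the sum over the support of \<open>\<Phi>\<^sub>n\<^sup>T\<close> into \<open>\<Phi>\<^sub>n(\<zeta>)\<close>,
  and a vanishing sub-sum into a relation \<open>g(\<zeta>) = 0\<close> where every coefficient of \<open>g\<close> is either \<open>0\<close>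
  or the corresponding coefficient of \<open>\<Phi>\<^sub>n\<close>. As \<open>\<Phi>\<^sub>n\<close> is irreducible, \<open>g\<close> is a constant multiple
  of \<open>\<Phi>\<^sub>n\<close>, so the sub-sum is empty or everything.

  Irreducibility follows Landau's argument. Let \<open>f\<close> be the (monic, integral) minimal polynomial of
  \<open>\<zeta>\<close>. For a prime \<open>p\<close>, \<open>f(\<zeta>\<^sup>p)\<close> is congruent to \<open>f(\<zeta>)\<^sup>p = 0\<close> modulo \<open>p\<close>, so its reduced
  representation as a polynomial in \<open>\<zeta>\<close> has all coefficients divisible by \<open>p\<close>. Only finitely many such
  representations occur, since \<open>\<zeta>\<^sup>p\<close> depends on \<open>p\<close> modulo \<open>n\<close> only; hence \<open>f(\<zeta>\<^sup>p) = 0\<close> for all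
  large \<open>p\<close>. Every residue class coprime to \<open>n\<close> contains a product of large primes, so all primitive
  \<open>n\<close>-th roots of unity are roots of \<open>f\<close>.
\<close>

section \<open>Evaluation of integer polynomials at complex numbers\<close>

abbreviation ipoly :: "int poly \<Rightarrow> complex \<Rightarrow> complex" where
  "ipoly f z \<equiv> poly (map_poly of_int f) z"

lemma ipoly_pCons: "ipoly (pCons a f) z = of_int a + z * ipoly f z"
  by (simp add: map_poly_pCons)

lemma ipoly_add: "ipoly (f + g) z = ipoly f z + ipoly g z"
  by (subst poly_add [symmetric], rule arg_cong [where f = "\<lambda>p. poly p z"])
     (simp add: poly_eq_iff coeff_map_poly)

lemma ipoly_diff: "ipoly (f - g) z = ipoly f z - ipoly g z"
  by (subst poly_diff [symmetric], rule arg_cong [where f = "\<lambda>p. poly p z"])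
     (simp add: poly_eq_iff coeff_map_poly)

lemma ipoly_smult: "ipoly (smult a f) z = of_int a * ipoly f z"
  by (simp add: map_poly_smult)

lemma ipoly_mult: "ipoly (f * g) z = ipoly f z * ipoly g z"
  by (induction f) (simp_all add: ipoly_add ipoly_pCons ipoly_smult algebra_simps)

lemma ipoly_power: "ipoly (f ^ k) z = ipoly f z ^ k"
  by (induction k) (simp_all add: ipoly_mult)

lemma ipoly_monom: "ipoly (monom a k) z = of_int a * z ^ k"
  by (simp add: map_poly_monom poly_monom)

lemma ipoly_pcompose_monom: "ipoly (pcompose f (monom 1 k)) z = ipoly f (z ^ k)"
  by (induction f)
     (simp_all add: pcompose_pCons ipoly_add ipoly_mult ipoly_monom map_poly_pCons)

section \<open>Monic division and minimal polynomials over the integers\<close>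

lemma monic_division:
  fixes f g :: "int poly"
  assumes "lead_coeff f = 1"
  obtains q r where "g = f * q + r" "r = 0 \<or> degree r < degree f"
proof -
  obtain q r where qr: "pseudo_divmod g f = (q, r)" by fastforce
  have "f \<noteq> 0" using assms by auto
  \<comment> \<open>Pseudo-division scales \<open>g\<close> by a power of the leading coefficient of
    \<open>f\<close>, which is 1 here.\<close>
  from pseudo_divmod [OF this qr] have "g = f * q + r" "r = 0 \<or> degree r < degree f"
    using assms by simp_all
  then show ?thesis by (rule that)
qed

text \<open>A primitive polynomial of least degree vanishing at \<open>z\<close> divides every other
  one up to an integer factor, which Gauss's lemma removes. Dividing the monic \<open>h\<close> then
  forces its leading coefficient to be 1 or -1.\<close>

lemma monic_minimal_int_poly:
  fixes z :: complex
  assumes h: "lead_coeff h = 1" "ipoly h z = 0"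
  obtains f where "lead_coeff f = 1" "ipoly f z = 0" "\<And>g. ipoly g z = 0 \<Longrightarrow> f dvd g"
proof -
  let ?P = "\<lambda>f. f \<noteq> 0 \<and> ipoly f z = 0"
  have ex: "?P h" using h by auto
  define f0 where "f0 = arg_min degree ?P"
  have f0: "?P f0" unfolding f0_def by (rule arg_min_natI [of ?P, OF ex])
  have min: "degree f0 \<le> degree g" if "?P g" for g
    unfolding f0_def by (rule arg_min_nat_le [of ?P, OF that])
  define f1 where "f1 = primitive_part f0"
  have f0_eq: "smult (content f0) f1 = f0" unfolding f1_def by simp
  have content_f1: "content f1 = 1" unfolding f1_def using f0 by simp
  have "f1 \<noteq> 0" using content_f1 by auto
  moreover have "ipoly f1 z = 0"
    using f0 arg_cong [OF f0_eq, of "\<lambda>f. ipoly f z"] by (auto simp: ipoly_smult)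
  ultimately have f1: "f1 \<noteq> 0" "ipoly f1 z = 0" by auto
  have deg: "degree f1 = degree f0" unfolding f1_def by simp
  have dvd: "f1 dvd g" if g: "ipoly g z = 0" for g
  proof -
    define r where "r = pseudo_mod g f1"
    obtain a q where aq: "a \<noteq> 0" "smult a g = f1 * q + r"
      using pseudo_mod(1) [OF f1(1), of g] unfolding r_def by blast
    have "r = 0 \<or> degree r < degree f1"
      using pseudo_mod(2) [OF f1(1), of g] unfolding r_def .
    moreover have "ipoly r z = 0"
      using arg_cong [OF aq(2), of "\<lambda>f. ipoly f z"] g f1
      by (simp add: ipoly_smult ipoly_add ipoly_mult)
    ultimately have "r = 0" using min [of r] deg by (metis linorder_not_le)
    then have eq: "smult a g = f1 * q" using aq by simp
    \<comment> \<open>Since \<open>f1\<close> has content 1, the multiplier \<open>a\<close> must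
      divide \<open>q\<close> and can be cancelled.\<close>
    have "content (smult a g) = content q"
      unfolding eq content_mult content_f1 by simp
    then have "a dvd content q" by (metis content_smult dvd_mult2 dvd_normalize_iff dvd_refl)
    then have "[:a:] dvd q" by (simp add: const_poly_dvd_iff_dvd_content)
    then obtain q' where "q = smult a q'" by (auto elim: dvdE)
    then have "smult a (g - f1 * q') = 0" using eq by (simp add: smult_diff_right)
    then have "g = f1 * q'" using aq(1) by simp
    then show ?thesis by simp
  qed
  define f where "f = smult (lead_coeff f1) f1"
  have "lead_coeff f1 dvd lead_coeff h"
    using dvd [OF h(2)] by (metis dvd_def lead_coeff_mult)
  then have unit: "lead_coeff f1 * lead_coeff f1 = 1"
    using h by (metis abs_mult_self_eq mult_1 zdvd1_eq)
  show ?thesis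
  proof
    show "lead_coeff f = 1" unfolding f_def using unit f1(1) by simp
    show "ipoly f z = 0" unfolding f_def using f1 by (simp add: ipoly_smult)
    have "f1 = smult (lead_coeff f1) f" unfolding f_def using unit by simp
    then have "f dvd f1" by (metis dvd_smult dvd_refl)
    then show "f dvd g" if "ipoly g z = 0" for g using dvd [OF that] by (rule dvd_trans)
  qed
qed

section \<open>Frobenius congruences modulo a prime\<close>

lemma prime_dvd_binomial_power_diff:
  fixes a b :: "'a :: comm_ring_1"
  assumes "prime p"
  shows "of_nat p dvd (a + b) ^ p - (a ^ p + b ^ p)"
proof -
  have p: "p > 0" using assms by (simp add: prime_gt_0_nat)
  have "(a + b) ^ p = (\<Sum>k\<le>p. of_nat (p choose k) * a ^ k * b ^ (p - k))"
    by (rule binomial_ring)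
  also have "\<dots> = (\<Sum>k\<in>{0,p}. of_nat (p choose k) * a ^ k * b ^ (p - k)) +
                   (\<Sum>k\<in>{..p} - {0,p}. of_nat (p choose k) * a ^ k * b ^ (p - k))"
    by (subst add.commute, rule sum.subset_diff) auto
  finally have "(a + b) ^ p - (a ^ p + b ^ p) =
                  (\<Sum>k\<in>{..p} - {0,p}. of_nat (p choose k) * a ^ k * b ^ (p - k))"
    using p by simp
  also have "of_nat p dvd \<dots>"
  proof (rule dvd_sum)
    fix k assume "k \<in> {..p} - {0,p}"
    then have "p dvd (p choose k)" using assms p by (intro dvd_choose_prime) auto
    then have "(of_nat p :: 'a) dvd of_nat (p choose k)" by (metis dvd_def of_nat_mult)
    then show "of_nat p dvd of_nat (p choose k) * a ^ k * b ^ (p - k)" by simp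
  qed
  finally show ?thesis .
qed

lemma prime_dvd_power_diff_self:
  fixes a :: int
  assumes "prime p"
  shows "int p dvd a ^ p - a"
proof (induction a rule: int_induct [where k = 0])
  case base
  then show ?case using assms by (simp add: prime_gt_0_nat power_0_left)
next
  case (step1 i)
  from dvd_add [OF this(2) prime_dvd_binomial_power_diff [OF assms, of i 1]]
  show ?case by (simp add: algebra_simps)
next
  case (step2 i)
  from dvd_diff [OF this(2) prime_dvd_binomial_power_diff [OF assms, of "i - 1" 1]]
  show ?case by (simp add: algebra_simps)
qed

text \<open>Induction on the coefficients: mixed binomial terms vanish modulo \<open>p\<close>, and
  Fermat's little theorem handles the constants.\<close>

lemma prime_dvd_pcompose_monom_diff_power:
  fixes f :: "int poly"
  assumes "prime p"
  shows "of_nat p dvd pcompose f (monom 1 p) - f ^ p"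
proof (induction f)
  case 0
  then show ?case using assms by (simp add: prime_gt_0_nat power_0_left)
next
  case (pCons a f)
  let ?x = "monom 1 1 :: int poly"
  have eq: "pCons a f = [:a:] + ?x * f"
    by (simp add: monom_altdef)
  have 1: "of_nat p dvd (pCons a f) ^ p - ([:a:] ^ p + (?x * f) ^ p)"
    unfolding eq by (rule prime_dvd_binomial_power_diff [OF assms])
  have 2: "of_nat p dvd [:a:] ^ p - [:a:]"
    using prime_dvd_power_diff_self [OF assms, of a]
    by (simp add: poly_const_pow of_nat_poly)
  have 3: "of_nat p dvd ?x ^ p * (pcompose f (monom 1 p) - f ^ p)"
    using pCons(2) by (rule dvd_mult)
  have "pcompose (pCons a f) (monom 1 p) - pCons a f ^ p =
          ?x ^ p * (pcompose f (monom 1 p) - f ^ p) - ([:a:] ^ p - [:a:])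
          - ((pCons a f) ^ p - ([:a:] ^ p + (?x * f) ^ p))"
    by (simp add: pcompose_pCons monom_power algebra_simps power_mult_distrib)
  then show ?case using 1 2 3 by (metis dvd_diff)
qed

section \<open>Conjugacy of the primitive roots\<close>

lemma large_prime_power_preserves_roots:
  fixes f :: "int poly" and z :: complex
  assumes monic: "lead_coeff f = 1" and f: "ipoly f z = 0"
    and min: "\<And>g. ipoly g z = 0 \<Longrightarrow> f dvd g"
    and z: "z ^ n = 1" "n > 0"
  obtains B :: nat where "\<And>p w. prime p \<Longrightarrow> p > B \<Longrightarrow> ipoly f w = 0 \<Longrightarrow> ipoly f (w ^ p) = 0"
proof -
  have "\<exists>g. ipoly g z = ipoly f (z ^ r) \<and> (g = 0 \<or> degree g < degree f)" for r
  proof -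
    obtain q g where "pcompose f (monom 1 r) = f * q + g" "g = 0 \<or> degree g < degree f"
      by (rule monic_division [OF monic])
    then show ?thesis
      using f ipoly_pcompose_monom [of f r z] by (auto simp: ipoly_add ipoly_mult)
  qed
  then obtain G where G: "\<And>r. ipoly (G r) z = ipoly f (z ^ r)"
      "\<And>r. G r = 0 \<or> degree (G r) < degree f"
    by metis
  \<comment> \<open>Exponents matter only modulo \<open>n\<close>, so finitely many remainders
    \<open>G r\<close> suffice and their coefficients have a common bound.\<close>
  define C where "C = (\<Union>r<n. (\<lambda>i. \<bar>coeff (G r) i\<bar>) ` {..degree f})"
  have finC: "finite C" unfolding C_def by auto
  define B where "B = nat (Max (insert 0 C))"
  have B: "\<bar>coeff (G r) i\<bar> \<le> int B" if "r < n" for r i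
  proof (cases "i \<le> degree f")
    case True
    then have "\<bar>coeff (G r) i\<bar> \<in> insert 0 C" unfolding C_def using that by auto
    then have "\<bar>coeff (G r) i\<bar> \<le> Max (insert 0 C)" using finC by (intro Max_ge) auto
    then show ?thesis unfolding B_def by linarith
  next
    case False
    then have "coeff (G r) i = 0" using G(2) [of r] by (auto intro: coeff_eq_0)
    then show ?thesis by simp
  qed
  show ?thesis
  proof (rule that [of B])
    fix p :: nat and w :: complex
    assume p: "prime p" "p > B" and w: "ipoly f w = 0"
    have p0: "p > 0" using p(1) by (simp add: prime_gt_0_nat)
    obtain s where "pcompose f (monom 1 p) - f ^ p = of_nat p * s"
      using prime_dvd_pcompose_monom_diff_power [OF p(1), of f] by (auto elim: dvdE)
    then have s: "pcompose f (monom 1 p) = f ^ p + smult (int p) s"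
      by (simp add: of_nat_poly algebra_simps)
    obtain q t where t: "s = f * q + t" "t = 0 \<or> degree t < degree f"
      by (rule monic_division [OF monic])
    \<comment> \<open>The polynomial \<open>t\<close> depends on \<open>p\<close> but not on the
      root \<open>u\<close>, so once \<open>t = 0\<close> is derived at \<open>z\<close>, it serves
      every root \<open>w\<close>.\<close>
    have pow: "ipoly f (u ^ p) = int p * ipoly t u" if "ipoly f u = 0" for u
      using that p0 unfolding ipoly_pcompose_monom [symmetric] s t(1)
      by (simp add: ipoly_add ipoly_mult ipoly_smult ipoly_power)
    have zp: "z ^ (p mod n) = z ^ p"
      by (metis (no_types) mult_div_mod_eq power_add power_mult z(1) power_one mult_1)
    have "ipoly (G (p mod n) - smult (int p) t) z = 0"
      unfolding ipoly_diff ipoly_smult G(1) zp pow [OF f] by simp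
    then have "f dvd G (p mod n) - smult (int p) t" by (rule min)
    moreover have "G (p mod n) - smult (int p) t = 0 \<or>
        degree (G (p mod n) - smult (int p) t) < degree f"
      using G(2) [of "p mod n"] t(2) by (auto intro: degree_diff_less)
    \<comment> \<open>A multiple of \<open>f\<close> of smaller degree than \<open>f\<close> is
      zero.\<close>
    ultimately have Gt: "G (p mod n) = smult (int p) t"
      by (metis dvd_imp_degree_le eq_iff_diff_eq_0 linorder_not_le)
    have "coeff t i = 0" for i
    proof (rule ccontr)
      assume nz: "coeff t i \<noteq> 0"
      have "int p * 1 \<le> int p * \<bar>coeff t i\<bar>"
        using nz by (intro mult_left_mono) auto
      also have "\<dots> = \<bar>coeff (G (p mod n)) i\<bar>" unfolding Gt by (simp add: abs_mult)
      also have "\<dots> \<le> int B" using z(2) by (intro B) simp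
      finally show False using p(2) by simp
    qed
    then have "t = 0" by (simp add: poly_eq_iff)
    then show "ipoly f (w ^ p) = 0" using pow [OF w] by simp
  qed
qed

text \<open>Add to \<open>r\<close> the product of \<open>n\<close> and all primes up to
  \<open>B\<close> not dividing \<open>r\<close>. Each prime up to \<open>B\<close> then divides
  exactly one of the two summands.\<close>

lemma ex_cong_large_prime_factors:
  fixes r n B :: nat
  assumes "coprime r n" "n > 0"
  obtains s where "s > 0" "[s = r] (mod n)" "\<And>q. prime q \<Longrightarrow> q dvd s \<Longrightarrow> q > B"
proof -
  define Q where "Q = {q. prime q \<and> q \<le> B \<and> \<not> q dvd r}"
  have finQ: "finite Q" unfolding Q_def by (rule finite_subset [of _ "{..B}"]) auto
  have P: "\<Prod>Q > 0" by (rule prod_pos) (auto simp: Q_def prime_gt_0_nat)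
  show ?thesis
  proof
    show "r + n * \<Prod>Q > 0" using assms P by simp
    show "[r + n * \<Prod>Q = r] (mod n)" by (simp add: cong_def)
    fix q assume q: "prime q" "q dvd r + n * \<Prod>Q"
    show "q > B"
    proof (rule ccontr)
      assume "\<not> B < q"
      show False
      proof (cases "q dvd r")
        case True
        then have "q dvd n * \<Prod>Q" using q by (simp add: dvd_add_right_iff)
        moreover have "\<not> q dvd n"
          using True assms q by (metis coprime_common_divisor_nat not_prime_1)
        ultimately have "q dvd \<Prod>Q" using q by (simp add: prime_dvd_mult_iff)
        then obtain q' where "q' \<in> Q" "q dvd q'"
          using prime_dvd_prod_iff [OF finQ, of q "\<lambda>x. x"] q(1) by auto
        then show False using q True unfolding Q_def
          by (auto dest: primes_dvd_imp_eq)
      next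
        case False
        then have "q \<in> Q" using q \<open>\<not> B < q\<close> unfolding Q_def by auto
        then have "q dvd n * \<Prod>Q" using finQ by (simp add: dvd_prodI [of Q q id, simplified])
        then show False using False q by (simp add: dvd_add_left_iff)
      qed
    qed
  qed
qed

text \<open>Prime factors of \<open>s\<close> are split off one at a time; \<open>z\<close> varies
  because the induction hypothesis is applied at \<open>z ^ p\<close>.\<close>

lemma power_preserves_roots:
  assumes "\<And>p w. prime p \<Longrightarrow> p > B \<Longrightarrow> P w \<Longrightarrow> P (w ^ p :: 'a :: monoid_mult)"
    and "s > 0" "\<And>q. prime q \<Longrightarrow> q dvd s \<Longrightarrow> q > (B :: nat)" "P z"
  shows "P (z ^ s)"
  using assms(2-)
proof (induction s arbitrary: z rule: prime_divisors_induct)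
  case (factor p s)
  have "P (z ^ p)" by (rule assms(1)) (use factor in auto)
  then have "P ((z ^ p) ^ s)" using factor by auto
  then show ?case by (simp add: power_mult)
qed auto

lemma primitive_root_unity_is_power:
  assumes z: "primitive_root_unity n z" and w: "primitive_root_unity n w"
  obtains r where "coprime r n" "w = z ^ r"
proof -
  have n: "n > 0" "z ^ n = 1" "w ^ n = 1"
    using z w by (auto simp: primitive_root_unity_def)
  have z0: "z \<noteq> 0" using n by (auto simp: power_0_left)
  have inj: "inj_on (\<lambda>r. z ^ r) {..<n}"
  proof (rule linorder_inj_onI)
    fix i j assume ij: "i < j" "i \<in> {..<n}" "j \<in> {..<n}"
    show "z ^ i \<noteq> z ^ j"
    proof
      assume "z ^ i = z ^ j"
      then have "z ^ (j - i) = 1" using ij z0 by (simp add: power_diff)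
      then show False using z ij by (auto simp: primitive_root_unity_def)
    qed
  qed auto
  \<comment> \<open>The \<open>n\<close> distinct powers of \<open>z\<close> exhaust the
    \<open>n\<close> roots of unity.\<close>
  have "(\<lambda>r. z ^ r) ` {..<n} = {w. w ^ n = 1}"
  proof (rule card_subset_eq)
    show "finite {w::complex. w ^ n = 1}" using n by (intro finite_roots_unity) auto
    show "(\<lambda>r. z ^ r) ` {..<n} \<subseteq> {w. w ^ n = 1}"
      using n by (auto simp: power_commutes power_mult [symmetric] mult.commute [of _ n])
        (simp add: power_mult)
    show "card ((\<lambda>r. z ^ r) ` {..<n}) = card {w::complex. w ^ n = 1}"
      using card_roots_unity_eq [of n] n by (simp add: card_image [OF inj])
  qed
  then obtain r where r: "w = z ^ r" using n by blast
  have "coprime r n"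
  proof (rule ccontr)
    assume "\<not> coprime r n"
    define d where "d = gcd r n"
    have "d \<noteq> 0" "d \<noteq> 1"
      using \<open>\<not> coprime r n\<close> n unfolding d_def by (auto simp: coprime_iff_gcd_eq_1)
    then have d: "d > 1" by simp
    obtain a b where ab: "r = d * a" "n = d * b"
      unfolding d_def by (metis dvdE gcd_dvd1 gcd_dvd2)
    \<comment> \<open>With \<open>b\<close> equal to \<open>n\<close> divided by the gcd, this
      bounds the order of \<open>w\<close> below \<open>n\<close>.\<close>
    have "w ^ b = (z ^ n) ^ a"
      unfolding r ab power_mult [symmetric] by (simp add: mult_ac)
    then have "w ^ b = 1" using n by simp
    moreover have "b > 0" "b < n" using d n(1) ab by auto
    ultimately show False using w by (auto simp: primitive_root_unity_def)
  qed
  then show ?thesis using r that by blast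
qed

text \<open>This is irreducibility of the cyclotomic polynomial in the form used below.\<close>

lemma ipoly_root_all_primitive_roots:
  assumes z: "primitive_root_unity n z" and w: "primitive_root_unity n w" and g: "ipoly g z = 0"
  shows "ipoly g w = 0"
proof -
  have n: "n > 0" "z ^ n = 1" using z by (auto simp: primitive_root_unity_def)
  have "lead_coeff (monom 1 n - 1 :: int poly) = 1"
  proof -
    have "degree (monom 1 n + (- 1) :: int poly) = degree (monom 1 n :: int poly)"
      by (rule degree_add_eq_left) (use n in \<open>simp add: degree_monom_eq\<close>)
    then show ?thesis using n by (simp add: degree_monom_eq coeff_1)
  qed
  moreover have "ipoly (monom 1 n - 1) z = 0"
    using n by (simp add: ipoly_diff ipoly_monom)
  ultimately obtain f where f: "lead_coeff f = 1" "ipoly f z = 0" "\<And>g. ipoly g z = 0 \<Longrightarrow> f dvd g"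
    by (rule monic_minimal_int_poly) blast
  obtain B where B: "\<And>p w. prime p \<Longrightarrow> p > B \<Longrightarrow> ipoly f w = 0 \<Longrightarrow> ipoly f (w ^ p) = 0"
    using large_prime_power_preserves_roots [OF f n(2,1)] by blast
  obtain r where r: "coprime r n" "w = z ^ r"
    using primitive_root_unity_is_power [OF z w] .
  obtain s where s: "s > 0" "[s = r] (mod n)" "\<And>q. prime q \<Longrightarrow> q dvd s \<Longrightarrow> q > B"
    using ex_cong_large_prime_factors [OF r(1) n(1)] by blast
  have "z ^ k = z ^ (k mod n)" for k
    by (metis (no_types) mult_div_mod_eq power_add power_mult n(2) power_one mult_1)
  then have "z ^ s = w" using s(2) r(2) by (metis cong_def)
  moreover have "ipoly f (z ^ s) = 0"
    by (rule power_preserves_roots [where P = "\<lambda>w. ipoly f w = 0", OF B s(1,3) f(2)])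
  moreover have "f dvd g" using f(3) g .
  ultimately show ?thesis by (auto simp: ipoly_mult elim: dvdE)
qed

section \<open>Degree and multiples of the cyclotomic polynomial\<close>

lemma degree_cyclotomic: "degree (cyclotomic n) = card {z. primitive_root_unity n z}"
proof -
  have "degree (cyclotomic n) = degree (cyclotomic_complex n)"
    unfolding of_int_cyclotomic [symmetric] by (simp add: degree_map_poly)
  also have "\<dots> = card {z. primitive_root_unity n z}"
    unfolding cyclotomic_complex_def by (subst degree_prod_sum_eq) auto
  finally show ?thesis .
qed

lemma lead_coeff_cyclotomic: "lead_coeff (cyclotomic n) = 1"
proof -
  have "of_int (lead_coeff (cyclotomic n)) = lead_coeff (cyclotomic_complex n)"
    unfolding of_int_cyclotomic [symmetric] by (simp add: degree_map_poly coeff_map_poly)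
  then show ?thesis unfolding cyclotomic_complex_def by (simp add: lead_coeff_prod)
qed

lemma ipoly_cyclotomic:
  assumes "primitive_root_unity n z"
  shows "ipoly (cyclotomic n) z = 0"
  unfolding of_int_cyclotomic cyclotomic_complex_def
  using assms finite_primitive_roots by (auto simp: poly_prod)

lemma ipoly_root_degree_le_cyclotomic:
  assumes z: "primitive_root_unity n z" and g: "ipoly g z = 0"
    and deg: "degree g \<le> degree (cyclotomic n)"
  shows "g = smult (coeff g (degree (cyclotomic n))) (cyclotomic n)"
proof -
  \<comment> \<open>The top coefficients cancel because the cyclotomic polynomial is monic;
    \<open>h\<close> then has too many roots for its degree.\<close>
  define h where "h = g - smult (coeff g (degree (cyclotomic n))) (cyclotomic n)"
  have "h = 0"
  proof (rule ccontr)
    assume h: "h \<noteq> 0"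
    have "degree h \<le> degree (cyclotomic n)"
      unfolding h_def using deg by (intro degree_diff_le) auto
    moreover have "coeff h (degree (cyclotomic n)) = 0"
      unfolding h_def using lead_coeff_cyclotomic by simp
    ultimately have less: "degree h < degree (cyclotomic n)"
      using h by (metis le_neq_implies_less leading_coeff_0_iff)
    have nz: "map_poly of_int h \<noteq> (0 :: complex poly)"
      using h by (simp add: map_poly_eq_0_iff)
    have "{w. primitive_root_unity n w} \<subseteq> {w. ipoly h w = 0}"
      using ipoly_root_all_primitive_roots [OF z _ g] ipoly_cyclotomic
      unfolding h_def by (auto simp: ipoly_diff ipoly_smult)
    then have "card {w. primitive_root_unity n w} \<le> card {w. ipoly h w = 0}"
      by (intro card_mono poly_roots_finite nz)
    also have "\<dots> \<le> degree (map_poly of_int h :: complex poly)"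
      by (rule card_poly_roots_bound [OF nz])
    finally have "degree (cyclotomic n) \<le> degree h"
      by (simp add: degree_cyclotomic degree_map_poly)
    then show False using less by simp
  qed
  then show ?thesis unfolding h_def by simp
qed

section \<open>Folding exponents for order \<open>2 * m\<close>\<close>

lemma primitive_root_unity_power_half:
  assumes "primitive_root_unity (2 * m) z"
  shows "z ^ m = -1"
proof -
  have "z ^ m \<noteq> 1" "(z ^ m) ^ 2 = 1"
    using assms by (auto simp: primitive_root_unity_def power_mult [symmetric] mult.commute)
  then show ?thesis by (metis power2_eq_1_iff)
qed

text \<open>Besides the primitive roots, \<open>x ^ m + 1\<close> has the root \<open>-1\<close>,
  whose order 2 is below \<open>2 * m\<close>.\<close>

lemma degree_cyclotomic_double_odd:
  assumes "odd m" "m > 1"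
  shows "degree (cyclotomic (2 * m)) < m"
proof -
  let ?p = "monom 1 m + 1 :: complex poly"
  have deg: "degree ?p \<le> m" by (intro degree_add_le) (simp_all add: degree_monom_le)
  have "coeff ?p m = 1" using assms by (simp add: coeff_1)
  then have nz: "?p \<noteq> 0" by (metis coeff_0 zero_neq_one)
  have "{z. primitive_root_unity (2 * m) z} \<subset> {z. poly ?p z = 0}"
  proof
    show "{z. primitive_root_unity (2 * m) z} \<subseteq> {z. poly ?p z = 0}"
      by (auto simp: poly_monom primitive_root_unity_power_half)
    have "\<not> primitive_root_unity (2 * m) (- 1)"
      using assms unfolding primitive_root_unity_def by (auto intro!: exI [of _ 2])
    moreover have "poly ?p (- 1) = 0" using assms by (simp add: poly_monom)
    ultimately show "{z. primitive_root_unity (2 * m) z} \<noteq> {z. poly ?p z = 0}" by blast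
  qed
  then have "card {z. primitive_root_unity (2 * m) z} < card {z. poly ?p z = 0}"
    by (intro psubset_card_mono poly_roots_finite nz)
  also have "\<dots> \<le> m" using card_poly_roots_bound [OF nz] deg by simp
  finally show ?thesis by (simp add: degree_cyclotomic)
qed

lemma poly_minimal_vanishing_sum_cyclotomic_T:
  assumes m: "odd m" "m > 1" and flat: "flat (cyclotomic (2 * m))"
    and z: "primitive_root_unity (2 * m) z"
  shows "poly_minimal_vanishing_sum (2 * m) z (cyclotomic_T (2 * m))"
proof -
  define c where "c = coeff (cyclotomic (2 * m))"
  let ?T = "cyclotomic_T (2 * m)"
  have deg: "degree (cyclotomic (2 * m)) < m" by (rule degree_cyclotomic_double_odd [OF m])
  have c0: "c i = 0" if "i \<ge> m" for i
    unfolding c_def using that deg by (intro coeff_eq_0) simp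
  have c: "c i \<in> {-1, 0, 1}" for i using flat unfolding flat_iff c_def by blast
  have T: "?T = map_poly (\<lambda>c. max c 0) (cyclotomic (2 * m)) +
      monom 1 m * map_poly (\<lambda>c. max (- c) 0) (cyclotomic (2 * m))"
    using cyclotomic_T_eq [of "2 * m"] by (simp add: pos_neg_parts_iff)
  \<comment> \<open>The positive part lies below \<open>m\<close> and the shifted negative part from
    \<open>m\<close> on, so they never overlap.\<close>
  have coeff_T: "coeff ?T i = (if i < m then max (c i) 0 else max (- c (i - m)) 0)" for i
    unfolding T c_def [symmetric] using c0 [of i]
    by (simp add: coeff_map_poly coeff_monom_mult c_def)
  have T01: "coeff ?T i \<in> {0, 1}" for i
    using c [of i] c [of "i - m"] by (auto simp: coeff_T)
  define K where "K = {e. coeff ?T e \<noteq> 0}"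
  have K_iff: "e \<in> K \<longleftrightarrow> (if e < m then c e = 1 else c (e - m) = -1)" for e
    using c [of e] c [of "e - m"] by (auto simp: K_def coeff_T)
  have K_sub: "K \<subseteq> {0..<2 * m}"
  proof
    fix e assume "e \<in> K"
    then show "e \<in> {0..<2 * m}" using c0 [of "e - m"] by (cases "m \<le> e - m") (auto simp: K_iff split: if_splits)
  qed
  have finK: "finite K" using finite_subset [OF K_sub] by simp
  \<comment> \<open>The folded polynomial of a sub-sum, using \<open>z ^ m = -1\<close>.\<close>
  define g where "g J = (\<Sum>e\<in>J. if e < m then monom 1 e else monom (- 1) (e - m) :: int poly)" for J
  have ipoly_g: "ipoly (g J) z = (\<Sum>e\<in>J. z ^ e)" if "J \<subseteq> K" for J
  proof -
    have "finite J" using finite_subset [OF that finK] .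
    moreover have "z ^ e = - (z ^ (e - m))" if "\<not> e < m" for e
    proof -
      have "z ^ (m + (e - m)) = - (z ^ (e - m))"
        unfolding power_add primitive_root_unity_power_half [OF z] by simp
      then show ?thesis using that by simp
    qed
    ultimately show ?thesis unfolding g_def
      by (induction J) (auto simp: ipoly_add ipoly_monom)
  qed
  \<comment> \<open>At most one of \<open>i\<close> and \<open>i + m\<close> lies in
    \<open>K\<close>, according to the sign of \<open>c i\<close>, so nothing cancels in the
    folding.\<close>
  have coeff_g: "coeff (g J) i = (if i \<in> J \<or> i + m \<in> J then c i else 0)" if J: "J \<subseteq> K" for J i
  proof -
    have fin: "finite J" using finite_subset [OF that finK] .
    show ?thesis
    proof (cases "i < m")
      case True
      have "coeff (g J) i = (\<Sum>e\<in>J. (if e = i then 1 else 0) - (if e = i + m then 1 else 0))"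
        unfolding g_def coeff_sum by (rule sum.cong) (use True in auto)
      also have "\<dots> = (if i \<in> J then 1 else 0) - (if i + m \<in> J then 1 else 0)"
        using fin by (simp add: sum_subtractf)
      also have "\<dots> = (if i \<in> J \<or> i + m \<in> J then c i else 0)"
        using J True K_iff [of i] K_iff [of "i + m"] by auto
      finally show ?thesis .
    next
      case False
      have "coeff (g J) i = 0"
        unfolding g_def coeff_sum by (rule sum.neutral) (use False J K_sub in auto)
      then show ?thesis using False c0 by simp
    qed
  qed
  have "g K = cyclotomic (2 * m)"
  proof (rule poly_eqI)
    fix i
    show "coeff (g K) i = coeff (cyclotomic (2 * m)) i"
      using coeff_g [of K i] c [of i] c0 [of i] K_iff [of i] K_iff [of "i + m"]
      unfolding c_def by auto
  qed
  then have sum_K: "(\<Sum>e\<in>K. z ^ e) = 0"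
    using ipoly_g [of K] ipoly_cyclotomic [OF z] by simp
  have K_ne: "K \<noteq> {}"
  proof -
    have "c (degree (cyclotomic (2 * m))) = 1"
      unfolding c_def by (rule lead_coeff_cyclotomic)
    then have "degree (cyclotomic (2 * m)) \<in> K" using deg by (simp add: K_iff)
    then show ?thesis by auto
  qed
  have minimal: "(\<Sum>e\<in>J. z ^ e) \<noteq> 0" if J: "J \<noteq> {}" "J \<subset> K" for J
  proof
    assume "(\<Sum>e\<in>J. z ^ e) = 0"
    then have root: "ipoly (g J) z = 0" using ipoly_g [of J] J by auto
    define a where "a = coeff (g J) (degree (cyclotomic (2 * m)))"
    have "degree (g J) \<le> degree (cyclotomic (2 * m))"
      by (rule degree_le) (use J in \<open>auto simp: coeff_g c_def coeff_eq_0\<close>)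
    then have "g J = smult a (cyclotomic (2 * m))"
      unfolding a_def by (rule ipoly_root_degree_le_cyclotomic [OF z root])
    then have a: "coeff (g J) i = a * c i" for i by (simp add: c_def)
    \<comment> \<open>The right side does not mention \<open>e\<close>, so \<open>J\<close> is empty
      or all of \<open>K\<close>.\<close>
    have "e \<in> J \<longleftrightarrow> a = 1" if e: "e \<in> K" for e
    proof -
      define i where "i = (if e < m then e else e - m)"
      have i: "i < m" "c i \<noteq> 0" "e = i \<or> e = i + m"
        using e K_sub K_iff [of e] unfolding i_def by auto
      have "(i \<in> J \<or> i + m \<in> J) \<longleftrightarrow> e \<in> J"
        using i J K_iff [of i] K_iff [of "i + m"] e by auto
      then have "a * c i = (if e \<in> J then c i else 0)"
        using a [of i] coeff_g [of J i] J by auto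
      then show ?thesis using i by (auto split: if_splits)
    qed
    then show False using J by blast
  qed
  have "ipoly ?T z = (\<Sum>e\<in>K. z ^ e)"
  proof -
    have "ipoly ?T z = (\<Sum>e\<le>degree ?T. of_int (coeff ?T e) * z ^ e)"
      by (simp add: poly_altdef degree_map_poly coeff_map_poly)
    also have "\<dots> = (\<Sum>e\<in>K. of_int (coeff ?T e) * z ^ e)"
      by (rule sum.mono_neutral_right) (auto simp: K_def le_degree)
    also have "\<dots> = (\<Sum>e\<in>K. z ^ e)"
      by (rule sum.cong) (use T01 in \<open>auto simp: K_def\<close>)
    finally show ?thesis .
  qed
  then show ?thesis
    unfolding poly_minimal_vanishing_sum_def minimal_vanishing_sum_def vanishing_sum_def
      K_def [symmetric]
    using T01 K_ne K_sub sum_K minimal by auto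
qed

theorem lemma2p1:
  fixes k n :: nat and p :: "nat \<Rightarrow> nat" and \<zeta> :: complex
  assumes "k \<ge> 1"
    and "\<And>i. i \<le> k \<Longrightarrow> prime (p i)"
    and "p 0 = 2"
    and "strict_mono_on {0..k} p"
    and "n = (\<Prod>i=0..k. p i)"
    and "flat (cyclotomic n)"
    and "primitive_root_unity n \<zeta>"
  shows "poly_minimal_vanishing_sum n \<zeta> (cyclotomic_T n)"
proof -
  \<comment> \<open>The cofactor of \<open>p 0 = 2\<close>: odd because the other primes exceed 2,
    and above 1 because \<open>k \<ge> 1\<close> supplies \<open>p 1\<close>.\<close>
  define m where "m = (\<Prod>i=1..k. p i)"
  have gt: "p i > 2" if "i \<in> {1..k}" for i
    using strict_mono_onD [OF assms(4), of 0 i] that assms(3) by auto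
  have "odd (p i)" if "i \<in> {1..k}" for i
    using prime_odd_nat [OF assms(2)] gt [OF that] that by auto
  then have odd: "odd m" unfolding m_def by (auto simp: prime_dvd_prod_iff)
  have "p 1 dvd m" unfolding m_def using assms(1) by (intro dvd_prodI) auto
  moreover have "m > 0" using odd by (rule odd_pos)
  ultimately have "p 1 \<le> m" by (rule dvd_imp_le)
  then have m1: "m > 1" using gt [of 1] assms(1) by simp
  have "n = 2 * m" unfolding m_def assms(5) using assms(3) by (simp add: prod.atLeast_Suc_atMost)
  then show ?thesis
    using poly_minimal_vanishing_sum_cyclotomic_T [OF odd m1] assms(6,7) by simp
qed

end
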